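(* Let $q\ge 3$ be an odd prime power and let $t$ be an integer with $0\le t\le \frac{q-1}{4}$ if $q\equiv 1 \pmod 4$, or $0\le t\le \frac{q-3}{4}$ if $q\equiv 3\pmod 4$. Then the mixed graph $G_{q,t}$ (defined in the context, for any admissible choice of the auxiliary sets) is a mixed graph of diameter $2$ with undirected degree $r=q+2t$, directed degree $z=\frac{q-1}{2}-2t$, and $2q^2$ vertices.
   Context: Mixed graphs. A mixed graph is a finite graph $G$ with vertex set $V(G)$, a set $E(G)$ of (undirected) edges and a set $A(G)$ of arcs (directed edges). Paths may traverse edges in either direction and arcs only in their direction; the distance from $u$ to $v$ is the length of a shortest path from $u$ to $v$ (infinite if there is none), and the diameter is the maximum distance over all ordered pairs of vertices. A mixed (regular) graph has undirected degree $r$ and directed degree $z$ if it is simple and every vertex is incident with exactly $r$ edges and is the initial vertex of exactly $z$ arcs. An arc written $(u,v)$ goes from $u$ to $v$. The graph $B_q$. Let $\mathbb{F}_q$ be the finite field of order $q$. Let $\mathcal{P}$ and $\mathcal{L}$ be two disjoint copies of $\mathbb{F}_q\times\mathbb{F}_q$; elements of $\mathcal{P}$ (points) are written $(x,y)$ and elements of $\mathcal{L}$ (lines) are written $[m,b]$. $B_q$ is the undirected bipartite graph with vertex set $\mathcal{P}\cup\mathcal{L}$ in which $(x,y)$ and $[m,b]$ are adjacent if and only if $y=mx+b$. The graph $G_{q,t}$. Let $M\subseteq \mathbb{F}_q\setminus\{0\}$ with $|M|=(q-1)/2$ be such that $u+v\neq 0$ for all $u,v\in M$; thus $\mathbb{F}_q\setminus\{0\}$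 is the disjoint union of $M$ and $-M$. Let $T=\{t_1,\dots,t_{2t}\}\subseteq M$ with $|T|=2t$, and put $t_i'=-t_i$. Set $T_1=\{t_i,t_i' : i=1,\dots,t\}$, $T_2=\{t_i,t_i' : i=t+1,\dots,2t\}$, $S=M\setminus T$ and $-S=(-M)\setminus(-T)$. Then $G_{q,t}$ is the mixed graph with $V(G_{q,t})=V(B_q)$, $E(G_{q,t})=E(B_q)\cup\{\{[m,b],[m,b+i]\}: m,b\in\mathbb{F}_q,\ i\in T_1\}\cup\{\{(x,y),(x,y+j)\}: x,y\in\mathbb{F}_q,\ j\in T_2\}$, $A(G_{q,t})=\{([m,b],[m,b+i]): m,b\in\mathbb{F}_q,\ i\in S\}\cup\{((x,y),(x,y+j)): x,y\in\mathbb{F}_q,\ j\in -S\}$. *)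

theory Defs
  imports
    "HOL-Library.Extended_Nat"
    "HOL-Library.Cardinality"
    "HOL-Number_Theory.Prime_Powers"
begin

record 'v mixed_graph =
  verts :: "'v set"
  edges :: "'v set set"
  arcs  :: "('v \<times> 'v) set"

definition mixed_graph :: "'v mixed_graph \<Rightarrow> bool" where
  "mixed_graph G \<longleftrightarrow>
     finite (verts G) \<and>
     (\<forall>e \<in> edges G. \<exists>u \<in> verts G. \<exists>v \<in> verts G. e = {u, v}) \<and>
     arcs G \<subseteq> verts G \<times> verts G"

text \<open>
  Simplicity is read in the strongest sense: there are no loops, and any two vertices are joined
  by at most one edge or arc. So an arc is never parallel to an edge, and two opposite arcs never
  occur together. Repeated edges and arcs are already excluded by the set representation.
\<close>

definition simple_mixed_graph :: "'v mixed_graph \<Rightarrow> bool" where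
  "simple_mixed_graph G \<longleftrightarrow>
     mixed_graph G \<and>
     (\<forall>v. {v} \<notin> edges G) \<and>
     (\<forall>v. (v, v) \<notin> arcs G) \<and>
     (\<forall>u v. (u, v) \<in> arcs G \<longrightarrow> {u, v} \<notin> edges G \<and> (v, u) \<notin> arcs G)"

definition mixed_regular :: "'v mixed_graph \<Rightarrow> nat \<Rightarrow> nat \<Rightarrow> bool" where
  "mixed_regular G r z \<longleftrightarrow>
     simple_mixed_graph G \<and>
     (\<forall>v \<in> verts G. card {e \<in> edges G. v \<in> e} = r \<and> card {a \<in> arcs G. fst a = v} = z)"

definition mixed_step :: "'v mixed_graph \<Rightarrow> 'v \<Rightarrow> 'v \<Rightarrow> bool" where
  "mixed_step G u v \<longleftrightarrow> {u, v} \<in> edges G \<or> (u, v) \<in> arcs G"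

text \<open>A path is represented by its list of vertices, so its length is one less than that of the list.\<close>

definition mixed_path :: "'v mixed_graph \<Rightarrow> 'v \<Rightarrow> 'v list \<Rightarrow> 'v \<Rightarrow> bool" where
  "mixed_path G u p v \<longleftrightarrow>
     p \<noteq> [] \<and> hd p = u \<and> last p = v \<and> distinct p \<and> set p \<subseteq> verts G \<and>
     successively (mixed_step G) p"

text \<open>If there is no path, the infimum is taken over the empty set and equals \<open>\<infinity>\<close>.\<close>

definition mixed_dist :: "'v mixed_graph \<Rightarrow> 'v \<Rightarrow> 'v \<Rightarrow> enat" where
  "mixed_dist G u v = (INF p \<in> {p. mixed_path G u p v}. enat (length p - 1))"

definition mixed_diameter :: "'v mixed_graph \<Rightarrow> enat" where
  "mixed_diameter G = (SUP (u, v) \<in> verts G \<times> verts G. mixed_dist G u v)"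

datatype 'a vertex = Point 'a 'a | Line 'a 'a

definition B_graph :: "('a::field) vertex mixed_graph" where
  "B_graph =
     \<lparr> verts = {Point x y | x y. True} \<union> {Line m b | m b. True},
       edges = {{Point x y, Line m b} | x y m b. y = m * x + b},
       arcs = {} \<rparr>"

text \<open>
  The parameters are the set \<open>M\<close>, the number \<open>t\<close> and the enumeration \<open>\<tau> 1, \<dots>, \<tau> (2 * t)\<close> of
  the set \<open>T\<close>. Values of \<open>\<tau>\<close> at other arguments are irrelevant.
\<close>

definition set_T :: "nat \<Rightarrow> (nat \<Rightarrow> 'a) \<Rightarrow> 'a set" where
  "set_T t \<tau> = \<tau> ` {1..2 * t}"

definition set_T1 :: "nat \<Rightarrow> (nat \<Rightarrow> 'a::field) \<Rightarrow> 'a set" where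
  "set_T1 t \<tau> = \<tau> ` {1..t} \<union> (\<lambda>i. - \<tau> i) ` {1..t}"

definition set_T2 :: "nat \<Rightarrow> (nat \<Rightarrow> 'a::field) \<Rightarrow> 'a set" where
  "set_T2 t \<tau> = \<tau> ` {t + 1..2 * t} \<union> (\<lambda>i. - \<tau> i) ` {t + 1..2 * t}"

definition set_S :: "'a set \<Rightarrow> nat \<Rightarrow> (nat \<Rightarrow> 'a) \<Rightarrow> 'a set" where
  "set_S M t \<tau> = M - set_T t \<tau>"

definition G_graph :: "'a set \<Rightarrow> nat \<Rightarrow> (nat \<Rightarrow> 'a::field) \<Rightarrow> 'a vertex mixed_graph" where
  "G_graph M t \<tau> =
     \<lparr> verts = verts B_graph,
       edges = edges B_graph
         \<union> {{Line m b, Line m (b + i)} | m b i. i \<in> set_T1 t \<tau>}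
         \<union> {{Point x y, Point x (y + j)} | x y j. j \<in> set_T2 t \<tau>},
       arcs = {(Line m b, Line m (b + i)) | m b i. i \<in> set_S M t \<tau>}
         \<union> {(Point x y, Point x (y + j)) | x y j. j \<in> uminus ` set_S M t \<tau>} \<rparr>"

end

theory Submission imports Defs begin

text \<open>
  Inside one column of points \<open>(x, _)\<close> the graph moves by adding elements of the connection set
  \<open>T\<^sub>2 \<union> -S\<close> (\<open>point_moves\<close>), and inside one pencil of parallel lines \<open>[m, _]\<close> by adding elements
  of \<open>T\<^sub>1 \<union> S\<close> (\<open>line_moves\<close>). Two properties of these sets give the diameter.

  First, each of them has \<open>(q - 1) / 2\<close> elements. Together with \<open>0\<close> it therefore occupies more than
  half of the additive group, and a set \<open>A\<close> of more than half of a finite group satisfies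
  \<open>A + A = UNIV\<close>, because \<open>A\<close> and \<open>d - A\<close> cannot be disjoint (\<open>more_than_half_sumset\<close>). So two
  points in the same column, or two parallel lines, are at distance at most \<open>2\<close>. Points in different
  columns lie on a common line and lines of different slope meet in a point, which again gives
  distance at most \<open>2\<close>.

  Second, the two sets together contain every nonzero element, because \<open>M\<close> and \<open>-M\<close> do so
  (\<open>moves_cover\<close>). Let \<open>d\<close> be the defect by which a point and a line fail to be incident. It can be
  repaired either by moving the point or by moving the line, and at least one of the two moves is
  available, in both directions of travel. So this distance is at most \<open>2\<close> as well.

  The value \<open>2\<close> is attained by two points in different columns, which are never joined directly.

  Regularity and simplicity rest on the fact that \<open>T\<^sub>1\<close> and \<open>T\<^sub>2\<close> are closed under negation, have
  \<open>2 t\<close> elements each and are disjoint from \<open>S \<union> -S\<close>, whereas \<open>S\<close> contains no two elements that are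
  negatives of each other.
\<close>

section \<open>Distances in mixed graphs\<close>

text \<open>
  Allowing each of the two steps to stay in place makes one case distinction serve for walks of
  length \<open>0\<close>, \<open>1\<close> and \<open>2\<close>: repetitions are removed here once and for all, since paths have
  distinct vertices.
\<close>

lemma mixed_dist_le_2:
  assumes "u \<in> verts G" "v \<in> verts G" "w \<in> verts G"
    and uw: "u = w \<or> mixed_step G u w" and wv: "w = v \<or> mixed_step G w v"
  shows "mixed_dist G u v \<le> 2"
proof -
  have "\<exists>p. mixed_path G u p v \<and> length p \<le> 3"
  proof -
    consider "u = v" | "u \<noteq> v" "mixed_step G u v"
      | "u \<noteq> v" "u \<noteq> w" "w \<noteq> v" "mixed_step G u w" "mixed_step G w v"
      using uw wv by auto
    then show ?thesis
    proof cases
      case 1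
      with assms show ?thesis by (intro exI[of _ "[u]"]) (simp add: mixed_path_def)
    next
      case 2
      with assms show ?thesis by (intro exI[of _ "[u, v]"]) (simp add: mixed_path_def)
    next
      case 3
      with assms show ?thesis by (intro exI[of _ "[u, w, v]"]) (simp add: mixed_path_def)
    qed
  qed
  then obtain p where p: "mixed_path G u p v" "length p \<le> 3" by blast
  then have "mixed_dist G u v \<le> enat (length p - 1)"
    unfolding mixed_dist_def by (intro INF_lower) simp
  also have "\<dots> \<le> enat 2" using p(2) by simp
  finally show ?thesis by (simp add: numeral_eq_enat)
qed

lemma mixed_dist_ge_2:
  assumes "u \<noteq> v" "\<not> mixed_step G u v"
  shows "2 \<le> mixed_dist G u v"
  unfolding mixed_dist_def
proof (rule INF_greatest)
  fix p assume "p \<in> {p. mixed_path G u p v}"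
  then have p: "p \<noteq> []" "hd p = u" "last p = v" "successively (mixed_step G) p"
    by (auto simp: mixed_path_def)
  have "length p \<noteq> 0" using p(1) by simp
  moreover have "length p \<noteq> 1" using p(2,3) assms(1) by (auto simp: length_Suc_conv)
  moreover have "length p \<noteq> 2"
    using p(2-4) assms(2) by (auto simp: length_Suc_conv numeral_2_eq_2)
  ultimately have "2 \<le> length p - 1" by linarith
  then show "2 \<le> enat (length p - 1)" by (simp add: numeral_eq_enat)
qed

lemma card_incident_edges:
  assumes "mixed_graph G"
  shows "card {e \<in> edges G. v \<in> e} = card {w. {v, w} \<in> edges G}"
proof -
  have "{e \<in> edges G. v \<in> e} = (\<lambda>w. {v, w}) ` {w. {v, w} \<in> edges G}"
  proof (intro equalityI subsetI)
    fix e assume e: "e \<in> {e \<in> edges G. v \<in> e}"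
    then have "e \<in> edges G" by simp
    with assms obtain a b where "e = {a, b}" unfolding mixed_graph_def by metis
    with e have "v = a \<or> v = b" by simp
    then obtain w where "e = {v, w}" using \<open>e = {a, b}\<close> insert_commute by metis
    with e show "e \<in> (\<lambda>w. {v, w}) ` {w. {v, w} \<in> edges G}" by simp
  qed blast
  moreover have "inj_on (\<lambda>w. {v, w}) {w. {v, w} \<in> edges G}"
    by (auto simp: inj_on_def doubleton_eq_iff)
  ultimately show ?thesis by (simp add: card_image)
qed

lemma card_out_arcs: "card {a \<in> arcs G. fst a = v} = card {w. (v, w) \<in> arcs G}"
proof -
  have "{a \<in> arcs G. fst a = v} = Pair v ` {w. (v, w) \<in> arcs G}" by auto
  then show ?thesis by (simp add: card_image inj_on_def)
qed

section \<open>Large subsets of a finite group\<close>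

lemma mem_uminus_image_iff: "d \<in> uminus ` A \<longleftrightarrow> - d \<in> A" for d :: "'a::group_add"
  by (auto intro: image_eqI[of _ _ "- d"])

text \<open>By counting, \<open>A\<close> and its reflection \<open>d - A\<close> overlap; a common element is the required summand.\<close>

lemma more_than_half_sumset:
  fixes A :: "'a::{ab_group_add,finite} set"
  assumes "CARD('a) < 2 * card A"
  obtains a where "a \<in> A" "d - a \<in> A"
proof -
  have "A \<inter> (\<lambda>a. d - a) ` A \<noteq> {}"
  proof
    assume "A \<inter> (\<lambda>a. d - a) ` A = {}"
    then have "card (A \<union> (\<lambda>a. d - a) ` A) = card A + card A"
      by (subst card_Un_disjoint) (auto simp: card_image inj_on_def)
    moreover have "card (A \<union> (\<lambda>a. d - a) ` A) \<le> CARD('a)"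
      by (intro card_mono) auto
    ultimately show False using assms by simp
  qed
  then show ?thesis using that by auto
qed

section \<open>The connection sets\<close>

locale admissible_parameters =
  fixes M :: "'a::{field,finite} set" and t :: nat and \<tau> :: "nat \<Rightarrow> 'a"
  assumes half: "CARD('a) = Suc (2 * card M)"
    and no_opposites: "\<And>u v. u \<in> M \<Longrightarrow> v \<in> M \<Longrightarrow> u + v \<noteq> 0"
    and T_subset: "set_T t \<tau> \<subseteq> M"
    and card_T: "card (set_T t \<tau>) = 2 * t"
begin

lemma zero_notin_M: "0 \<notin> M"
  using no_opposites[of 0 0] by auto

lemma uminus_notin_M: "u \<in> M \<Longrightarrow> - u \<notin> M"
  using no_opposites[of u "- u"] by auto

lemma M_or_uminus_M:
  assumes "d \<noteq> 0"
  shows "d \<in> M \<or> - d \<in> M"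
proof -
  have "M \<inter> uminus ` M = {}" using uminus_notin_M by auto
  then have "card (M \<union> uminus ` M) = card (UNIV - {0 :: 'a})"
    using half by (simp add: card_Un_disjoint card_image card_Diff_singleton)
  moreover have "M \<union> uminus ` M \<subseteq> UNIV - {0}" using zero_notin_M by auto
  ultimately have "M \<union> uminus ` M = UNIV - {0}" by (intro card_subset_eq) auto
  with assms show ?thesis by force
qed

lemma inj_tau: "inj_on \<tau> {1..2 * t}"
  using card_T unfolding set_T_def by (intro eq_card_imp_inj_on) auto

lemma tau_in_M: "i \<in> {1..2 * t} \<Longrightarrow> \<tau> i \<in> M"
  using T_subset by (auto simp: set_T_def)

text \<open>No two of the elements \<open>\<plusminus>\<tau> i\<close> coincide, since \<open>\<tau>\<close> is injective and \<open>M\<close> does not meet \<open>-M\<close>.\<close>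

lemma card_symmetric_part:
  assumes "I \<subseteq> {1..2 * t}"
  shows "card (\<tau> ` I \<union> (\<lambda>i. - \<tau> i) ` I) = 2 * card I"
proof -
  have inj: "inj_on \<tau> I" using inj_tau assms by (rule inj_on_subset)
  then have "inj_on (\<lambda>i. - \<tau> i) I" by (auto simp: inj_on_def)
  moreover have "\<tau> ` I \<inter> (\<lambda>i. - \<tau> i) ` I = {}"
  proof -
    have "\<tau> ` I \<subseteq> M" using tau_in_M assms by blast
    moreover have "(\<lambda>i. - \<tau> i) ` I \<inter> M = {}"
      using tau_in_M uminus_notin_M assms by blast
    ultimately show ?thesis by blast
  qed
  moreover have "finite I" using assms finite_subset by blast
  ultimately show ?thesis using inj by (simp add: card_Un_disjoint card_image)
qed

lemma card_T1: "card (set_T1 t \<tau>) = 2 * t"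
  unfolding set_T1_def by (subst card_symmetric_part) auto

lemma card_T2: "card (set_T2 t \<tau>) = 2 * t"
  unfolding set_T2_def by (subst card_symmetric_part) auto

lemma card_S: "card (set_S M t \<tau>) = card M - 2 * t"
  unfolding set_S_def using T_subset card_T by (simp add: card_Diff_subset)

lemma T1_T2_cover: "set_T1 t \<tau> \<union> set_T2 t \<tau> = set_T t \<tau> \<union> uminus ` set_T t \<tau>"
proof -
  have "{1..2 * t} = {1..t} \<union> {t + 1..2 * t}" by auto
  then show ?thesis
    unfolding set_T_def set_T1_def set_T2_def by (simp add: image_Un image_image Un_ac)
qed

lemma uminus_T1: "- d \<in> set_T1 t \<tau> \<longleftrightarrow> d \<in> set_T1 t \<tau>"
proof -
  have "x \<in> set_T1 t \<tau> \<Longrightarrow> - x \<in> set_T1 t \<tau>" for x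
    unfolding set_T1_def by auto
  from this[of d] this[of "- d"] show ?thesis by auto
qed

lemma uminus_T2: "- d \<in> set_T2 t \<tau> \<longleftrightarrow> d \<in> set_T2 t \<tau>"
proof -
  have "x \<in> set_T2 t \<tau> \<Longrightarrow> - x \<in> set_T2 t \<tau>" for x
    unfolding set_T2_def by auto
  from this[of d] this[of "- d"] show ?thesis by auto
qed

lemma S_disjoint_T12:
  assumes "d \<in> set_S M t \<tau>"
  shows "d \<notin> set_T1 t \<tau> \<union> set_T2 t \<tau>"
  unfolding T1_T2_cover using assms uminus_notin_M T_subset by (auto simp: set_S_def)

lemma zero_notin_T12: "0 \<notin> set_T1 t \<tau> \<union> set_T2 t \<tau>"
  unfolding T1_T2_cover using zero_notin_M T_subset by auto

lemma zero_notin_S: "0 \<notin> set_S M t \<tau>"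
  using zero_notin_M by (simp add: set_S_def)

lemma uminus_notin_S: "d \<in> set_S M t \<tau> \<Longrightarrow> - d \<notin> set_S M t \<tau>"
  using uminus_notin_M by (simp add: set_S_def)

definition line_moves :: "'a set" where
  "line_moves = set_T1 t \<tau> \<union> set_S M t \<tau>"

definition point_moves :: "'a set" where
  "point_moves = set_T2 t \<tau> \<union> uminus ` set_S M t \<tau>"

text \<open>
  The signs matter: lines move along \<open>S\<close> and points along \<open>-S\<close>, and this opposite orientation is
  what makes the two connection sets complementary.
\<close>

lemma moves_cover:
  assumes "d \<noteq> 0"
  shows "d \<in> point_moves \<or> d \<in> line_moves"
proof -
  have "d \<in> set_T t \<tau> \<union> uminus ` set_T t \<tau> \<or> d \<in> set_S M t \<tau> \<or> - d \<in> set_S M t \<tau>"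
    using M_or_uminus_M[OF assms] unfolding set_S_def by force
  then show ?thesis
    unfolding T1_T2_cover[symmetric] point_moves_def line_moves_def by force
qed

lemma two_t_le: "2 * t \<le> card M"
  using card_mono[OF _ T_subset] card_T by simp

lemma card_line_moves: "card line_moves = card M"
proof -
  have "set_T1 t \<tau> \<inter> set_S M t \<tau> = {}" using S_disjoint_T12 by auto
  then show ?thesis
    unfolding line_moves_def using two_t_le by (simp add: card_Un_disjoint card_T1 card_S)
qed

lemma card_point_moves: "card point_moves = card M"
proof -
  have "set_T2 t \<tau> \<inter> uminus ` set_S M t \<tau> = {}"
    using S_disjoint_T12 uminus_T2 by auto
  then show ?thesis
    unfolding point_moves_def using two_t_le
    by (simp add: card_Un_disjoint card_image card_T2 card_S)
qed

lemma zero_notin_moves: "0 \<notin> line_moves" "0 \<notin> point_moves"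
  using zero_notin_T12 zero_notin_S by (auto simp: line_moves_def point_moves_def)

lemma line_moves_sumset: obtains a where "a \<in> insert 0 line_moves" "d - a \<in> insert 0 line_moves"
  by (rule more_than_half_sumset[of "insert 0 line_moves"])
    (use half card_line_moves zero_notin_moves in auto)

lemma point_moves_sumset: obtains a where "a \<in> insert 0 point_moves" "d - a \<in> insert 0 point_moves"
  by (rule more_than_half_sumset[of "insert 0 point_moves"])
    (use half card_point_moves zero_notin_moves in auto)

section \<open>Adjacency, simplicity and regularity\<close>

abbreviation G :: "'a vertex mixed_graph" where
  "G \<equiv> G_graph M t \<tau>"

lemma verts_G: "verts G = UNIV"
proof -
  have "v \<in> verts G" for v by (cases v) (auto simp: G_graph_def B_graph_def)
  then show ?thesis by blast
qed

lemma card_verts_G: "card (verts G) = 2 * CARD('a) ^ 2"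
proof -
  have *: "verts G = case_prod Point ` UNIV \<union> case_prod Line ` UNIV"
    by (auto simp: G_graph_def B_graph_def)
  have "card (verts G) = card (case_prod Point ` UNIV :: 'a vertex set)
      + card (case_prod Line ` UNIV :: 'a vertex set)"
    unfolding * by (rule card_Un_disjoint) auto
  also have "\<dots> = CARD('a \<times> 'a) + CARD('a \<times> 'a)"
    by (subst (1 2) card_image) (auto simp: inj_on_def)
  finally show ?thesis by (simp add: power2_eq_square)
qed

lemma finite_verts_G: "finite (verts G)"
  by (rule card_ge_0_finite) (simp add: card_verts_G)

lemma edge_Point_Line: "{Point x y, Line m b} \<in> edges G \<longleftrightarrow> y = m * x + b"
  by (auto simp: G_graph_def B_graph_def doubleton_eq_iff)

lemma edge_Line_Point: "{Line m b, Point x y} \<in> edges G \<longleftrightarrow> y = m * x + b"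
  using edge_Point_Line by (simp add: insert_commute)

lemma edge_Point_Point:
  "{Point x y, Point x' y'} \<in> edges G \<longleftrightarrow> x' = x \<and> y' - y \<in> set_T2 t \<tau>"
proof
  assume "{Point x y, Point x' y'} \<in> edges G"
  then obtain j where j: "j \<in> set_T2 t \<tau>" and "x' = x" "y' = y + j \<or> y = y' + j"
    by (auto simp: G_graph_def B_graph_def doubleton_eq_iff)
  moreover have "- j \<in> set_T2 t \<tau>" using j by (simp add: uminus_T2)
  ultimately show "x' = x \<and> y' - y \<in> set_T2 t \<tau>" by auto
next
  have "j \<in> set_T2 t \<tau> \<Longrightarrow> {Point x y, Point x (y + j)} \<in> edges G" for j
    unfolding G_graph_def by auto
  from this[of "y' - y"]
  show "x' = x \<and> y' - y \<in> set_T2 t \<tau>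
      \<Longrightarrow> {Point x y, Point x' y'} \<in> edges G"
    by simp
qed

lemma edge_Line_Line:
  "{Line m b, Line m' b'} \<in> edges G \<longleftrightarrow> m' = m \<and> b' - b \<in> set_T1 t \<tau>"
proof
  assume "{Line m b, Line m' b'} \<in> edges G"
  then obtain j where j: "j \<in> set_T1 t \<tau>" and "m' = m" "b' = b + j \<or> b = b' + j"
    by (auto simp: G_graph_def B_graph_def doubleton_eq_iff)
  moreover have "- j \<in> set_T1 t \<tau>" using j by (simp add: uminus_T1)
  ultimately show "m' = m \<and> b' - b \<in> set_T1 t \<tau>" by auto
next
  have "j \<in> set_T1 t \<tau> \<Longrightarrow> {Line m b, Line m (b + j)} \<in> edges G" for j
    unfolding G_graph_def by auto
  from this[of "b' - b"]
  show "m' = m \<and> b' - b \<in> set_T1 t \<tau>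
      \<Longrightarrow> {Line m b, Line m' b'} \<in> edges G"
    by simp
qed

lemma arc_iffs:
  "(Point x y, Point x' y') \<in> arcs G \<longleftrightarrow> x' = x \<and> y - y' \<in> set_S M t \<tau>"
  "(Line m b, Line m' b') \<in> arcs G \<longleftrightarrow> m' = m \<and> b' - b \<in> set_S M t \<tau>"
  "(Point x y, Line m b) \<notin> arcs G"
  "(Line m b, Point x y) \<notin> arcs G"
proof -
  have "j \<in> uminus ` set_S M t \<tau> \<Longrightarrow> (Point x y, Point x (y + j)) \<in> arcs G" for j
    unfolding G_graph_def by simp
  from this[of "y' - y"] have "y - y' \<in> set_S M t \<tau> \<Longrightarrow> (Point x y, Point x y') \<in> arcs G"
    by (simp add: mem_uminus_image_iff)
  moreover have "x' = x \<and> y - y' \<in> set_S M t \<tau>" if "(Point x y, Point x' y') \<in> arcs G"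
    using that by (auto simp: G_graph_def)
  ultimately show "(Point x y, Point x' y') \<in> arcs G \<longleftrightarrow> x' = x \<and> y - y' \<in> set_S M t \<tau>"
    by blast
  have "i \<in> set_S M t \<tau> \<Longrightarrow> (Line m b, Line m (b + i)) \<in> arcs G" for i
    unfolding G_graph_def by simp
  from this[of "b' - b"]
  show "(Line m b, Line m' b') \<in> arcs G \<longleftrightarrow> m' = m \<and> b' - b \<in> set_S M t \<tau>"
    by (auto simp: G_graph_def)
qed (auto simp: G_graph_def)

lemmas adjacency = edge_Point_Line edge_Line_Point edge_Point_Point edge_Line_Line arc_iffs

lemma mixed_graph_G: "mixed_graph G"
proof -
  have "\<exists>u v. e = {u, v}" if "e \<in> edges G" for e
    using that unfolding G_graph_def B_graph_def by auto
  then show ?thesis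
    using finite_verts_G by (auto simp: mixed_graph_def verts_G)
qed

lemma simple_mixed_graph_G: "simple_mixed_graph G"
  unfolding simple_mixed_graph_def
proof (intro conjI allI impI)
  show "mixed_graph G" by (rule mixed_graph_G)
  fix v
  have "{v, v} \<notin> edges G" using zero_notin_T12
    by (cases v) (simp_all only: adjacency diff_self Un_iff de_Morgan_disj simp_thms)
  then show "{v} \<notin> edges G" by simp
  show "(v, v) \<notin> arcs G" using zero_notin_S by (cases v) (auto simp: adjacency)
next
  fix u v assume uv: "(u, v) \<in> arcs G"
  show "{u, v} \<notin> edges G"
  proof (cases u; cases v)
    fix x y x' y' assume "u = Point x y" "v = Point x' y'"
    with uv S_disjoint_T12[of "y - y'"] uminus_T2[of "y - y'"] show ?thesis
      by (auto simp: adjacency)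
  next
    fix m b m' b' assume "u = Line m b" "v = Line m' b'"
    with uv S_disjoint_T12[of "b' - b"] show ?thesis by (auto simp: adjacency)
  qed (use uv in \<open>auto simp: adjacency\<close>)
  show "(v, u) \<notin> arcs G"
  proof (cases u; cases v)
    fix x y x' y' assume "u = Point x y" "v = Point x' y'"
    with uv uminus_notin_S[of "y - y'"] show ?thesis by (auto simp: adjacency)
  next
    fix m b m' b' assume "u = Line m b" "v = Line m' b'"
    with uv uminus_notin_S[of "b' - b"] show ?thesis by (auto simp: adjacency)
  qed (use uv in \<open>auto simp: adjacency\<close>)
qed

lemma eq_plus_iff: "c = a + d \<longleftrightarrow> d = c - a" for a c d :: 'a
  by auto

lemma card_edge_neighbours: "card {w. {v, w} \<in> edges G} = CARD('a) + 2 * t"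
proof (cases v)
  case (Point x y)
  have "{w. {v, w} \<in> edges G}
      = (\<lambda>m. Line m (y - m * x)) ` UNIV \<union> (\<lambda>j. Point x (y + j)) ` set_T2 t \<tau>" (is "_ = ?R")
  proof (intro set_eqI)
    fix w
    show "w \<in> {w. {v, w} \<in> edges G} \<longleftrightarrow> w \<in> ?R"
      by (cases w) (auto simp: Point adjacency image_iff eq_plus_iff)
  qed
  also have "card \<dots> = CARD('a) + card (set_T2 t \<tau>)"
    by (subst card_Un_disjoint) (auto simp: card_image inj_on_def)
  finally show ?thesis by (simp add: card_T2)
next
  case (Line m b)
  have "{w. {v, w} \<in> edges G}
      = (\<lambda>x. Point x (m * x + b)) ` UNIV \<union> (\<lambda>i. Line m (b + i)) ` set_T1 t \<tau>" (is "_ = ?R")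
  proof (intro set_eqI)
    fix w
    show "w \<in> {w. {v, w} \<in> edges G} \<longleftrightarrow> w \<in> ?R"
      by (cases w) (auto simp: Line adjacency image_iff eq_plus_iff)
  qed
  also have "card \<dots> = CARD('a) + card (set_T1 t \<tau>)"
    by (subst card_Un_disjoint) (auto simp: card_image inj_on_def)
  finally show ?thesis by (simp add: card_T1)
qed

lemma card_arc_neighbours: "card {w. (v, w) \<in> arcs G} = card M - 2 * t"
proof (cases v)
  case (Point x y)
  have "{w. (v, w) \<in> arcs G} = (\<lambda>i. Point x (y - i)) ` set_S M t \<tau>" (is "_ = ?R")
  proof (intro set_eqI)
    fix w
    show "w \<in> {w. (v, w) \<in> arcs G} \<longleftrightarrow> w \<in> ?R"
      by (cases w) (auto simp: Point adjacency image_iff intro: rev_bexI)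
  qed
  also have "card \<dots> = card (set_S M t \<tau>)"
    by (auto simp: card_image inj_on_def)
  finally show ?thesis by (simp add: card_S)
next
  case (Line m b)
  have "{w. (v, w) \<in> arcs G} = (\<lambda>i. Line m (b + i)) ` set_S M t \<tau>" (is "_ = ?R")
  proof (intro set_eqI)
    fix w
    show "w \<in> {w. (v, w) \<in> arcs G} \<longleftrightarrow> w \<in> ?R"
      by (cases w) (auto simp: Line adjacency image_iff eq_plus_iff)
  qed
  also have "card \<dots> = card (set_S M t \<tau>)"
    by (auto simp: card_image inj_on_def)
  finally show ?thesis by (simp add: card_S)
qed

lemma mixed_regular_G: "mixed_regular G (CARD('a) + 2 * t) (card M - 2 * t)"
  unfolding mixed_regular_def
  by (simp add: simple_mixed_graph_G card_incident_edges[OF mixed_graph_G] card_out_arcs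
      card_edge_neighbours card_arc_neighbours)

section \<open>Diameter\<close>

lemma step_iffs:
  "mixed_step G (Point x y) (Point x' y') \<longleftrightarrow> x' = x \<and> y' - y \<in> point_moves"
  "mixed_step G (Line m b) (Line m' b') \<longleftrightarrow> m' = m \<and> b' - b \<in> line_moves"
  "mixed_step G (Point x y) (Line m b) \<longleftrightarrow> y = m * x + b"
  "mixed_step G (Line m b) (Point x y) \<longleftrightarrow> y = m * x + b"
  by (auto simp only: mixed_step_def adjacency point_moves_def line_moves_def
      mem_uminus_image_iff minus_diff_eq Un_iff)

lemma mixed_dist_G_le_2: "mixed_dist G u v \<le> 2"
proof -
  have "\<exists>w. (u = w \<or> mixed_step G u w) \<and> (w = v \<or> mixed_step G w v)"
  proof (cases u; cases v)
    fix x y x' y' assume uv: "u = Point x y" "v = Point x' y'"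
    show ?thesis
    proof (cases "x = x'")
      case True
      obtain a where "a \<in> insert 0 point_moves" "y' - y - a \<in> insert 0 point_moves"
        by (rule point_moves_sumset)
      with True show ?thesis
        by (intro exI[of _ "Point x (y + a)"]) (auto simp: uv step_iffs algebra_simps)
    next
      case False
      \<comment> \<open>the line through both points\<close>
      define m where "m = (y' - y) / (x' - x)"
      have "y' = m * (x' - x) + y" using False by (simp add: m_def)
      also have "\<dots> = m * x' + (y - m * x)" by (simp add: right_diff_distrib)
      finally have "mixed_step G (Line m (y - m * x)) v" by (simp only: uv step_iffs)
      moreover have "mixed_step G u (Line m (y - m * x))" by (simp add: uv step_iffs)
      ultimately show ?thesis by blast
    qed
  next
    fix m b m' b' assume uv: "u = Line m b" "v = Line m' b'"
    show ?thesis
    proof (cases "m = m'")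
      case True
      obtain a where "a \<in> insert 0 line_moves" "b' - b - a \<in> insert 0 line_moves"
        by (rule line_moves_sumset)
      with True show ?thesis
        by (intro exI[of _ "Line m (b + a)"]) (auto simp: uv step_iffs algebra_simps)
    next
      case False
      \<comment> \<open>the intersection point of the two lines\<close>
      define x where "x = (b' - b) / (m - m')"
      have "m * x + b = (m - m') * x + (m' * x + b)" by (simp add: left_diff_distrib)
      also have "\<dots> = m' * x + b'" using False by (simp add: x_def)
      finally have "mixed_step G (Point x (m * x + b)) v" by (simp only: uv step_iffs)
      moreover have "mixed_step G u (Point x (m * x + b))" by (simp add: uv step_iffs)
      ultimately show ?thesis by blast
    qed
  next
    fix x y m b assume uv: "u = Point x y" "v = Line m b"
    \<comment> \<open>Either the point moves onto the line, or the parallel line through the point moves to it.\<close>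
    define d where "d = m * x + b - y"
    consider "d = 0" | "d \<in> point_moves" | "d \<in> line_moves" using moves_cover by blast
    then show ?thesis
    proof cases
      case 1
      then show ?thesis by (intro exI[of _ v]) (simp add: uv step_iffs d_def)
    next
      case 2
      then show ?thesis
        by (intro exI[of _ "Point x (m * x + b)"]) (simp add: uv step_iffs d_def)
    next
      case 3
      then show ?thesis
        by (intro exI[of _ "Line m (y - m * x)"]) (simp add: uv step_iffs d_def algebra_simps)
    qed
  next
    fix m b x y assume uv: "u = Line m b" "v = Point x y"
    \<comment> \<open>The parallel line through the point is reached first, or the point of the line in its column.\<close>
    define d where "d = y - (m * x + b)"
    consider "d = 0" | "d \<in> point_moves" | "d \<in> line_moves" using moves_cover by blast
    then show ?thesis
    proof cases
      case 1
      then show ?thesis by (intro exI[of _ v]) (simp add: uv step_iffs d_def)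
    next
      case 2
      then show ?thesis
        by (intro exI[of _ "Point x (m * x + b)"]) (simp add: uv step_iffs d_def)
    next
      case 3
      then show ?thesis
        by (intro exI[of _ "Line m (y - m * x)"]) (simp add: uv step_iffs d_def algebra_simps)
    qed
  qed
  then show ?thesis using mixed_dist_le_2 by (metis UNIV_I verts_G)
qed

lemma mixed_diameter_G: "mixed_diameter G = 2"
proof (rule antisym)
  show "mixed_diameter G \<le> 2"
    unfolding mixed_diameter_def by (rule SUP_least) (auto simp: mixed_dist_G_le_2)
  have "2 \<le> mixed_dist G (Point 0 0) (Point 1 0)"
    by (rule mixed_dist_ge_2) (simp_all add: step_iffs)
  also have "\<dots> \<le> mixed_diameter G"
    unfolding mixed_diameter_def
    by (rule SUP_upper2[of "(Point 0 0, Point 1 0)"]) (simp_all add: verts_G)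
  finally show "2 \<le> mixed_diameter G" .
qed

end

section \<open>The mixed graphs \<open>G\<^bsub>q,t\<^esub>\<close>\<close>

theorem theorem3p2:
  fixes q t :: nat
    and M :: "'a::{field,finite} set"
    and \<tau> :: "nat \<Rightarrow> 'a"
  assumes "q \<ge> 3" and "odd q" and "primepow q"
    and "CARD('a) = q"
    and "q mod 4 = 1 \<Longrightarrow> t \<le> (q - 1) div 4"
    and "q mod 4 = 3 \<Longrightarrow> t \<le> (q - 3) div 4"
    and "M \<subseteq> UNIV - {0}"
    and "card M = (q - 1) div 2"
    and "\<And>u v. u \<in> M \<Longrightarrow> v \<in> M \<Longrightarrow> u + v \<noteq> 0"
    and "set_T t \<tau> \<subseteq> M"
    and "card (set_T t \<tau>) = 2 * t"
  shows "mixed_regular (G_graph M t \<tau>) (q + 2 * t) ((q - 1) div 2 - 2 * t)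
    \<and> mixed_diameter (G_graph M t \<tau>) = 2
    \<and> card (verts (G_graph M t \<tau>)) = 2 * q ^ 2"
proof -
  have half: "CARD('a) = Suc (2 * card M)"
    using assms(1,2,4,8) by (auto elim!: oddE)
  interpret admissible_parameters M t \<tau>
    using half assms(9-11) by unfold_locales auto
  show ?thesis
    using mixed_regular_G mixed_diameter_G card_verts_G assms(4,8) by simp
qed

end
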